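(* Let $\succsim$ be a CRDU preference relation on $\mathcal X$ with $\succsim$-matching probability $\nu$. Then $\succsim$ satisfies Property (RAA) if and only if $\nu$ is set-wise dominated by the reference probability measure $\mathbb Q$, i.e. $\nu(A)\le\mathbb Q(A)$ for all $A\in\mathcal F$ (equivalently, $\mathbb Q\in\mathfrak C(\nu)$).
   Context: Setting. $(\Omega,\mathcal F)$ is a measurable space, $\mathcal G\subseteq\mathcal F$ is a sub-$\sigma$-algebra, and $\mathbb P:\mathcal G\to[0,1]$ is a (countably additive) probability measure that is atomless: $\{\mathbb P(B):B\in\mathcal G,\,B\subseteq A\}=[0,\mathbb P(A)]$ for every $A\in\mathcal G$. The reference probability measure $\mathbb Q$ is a fixed (countably additive) probability measure on $(\Omega,\mathcal F)$ with $\mathbb Q|_{\mathcal G}=\mathbb P$. $\mathcal X$ is the set of acts, i.e. bounded $\mathcal F$-measurable functions $X:\Omega\to\mathbb R$; $\mathcal X(\mathcal G)$ is the set of $\mathcal G$-measurable acts. A preference relation $\succsim$ is a total preorder on $\mathcal X$ with symmetric part $\simeq$. A capacity is $\nu:\mathcal F\to\mathbb R$ with $\nu(\varnothing)=0$, $\nu(\Omega)=1$, and $\nu(A)\le\nu(B)$ whenever $A\subseteq B$. It is continuous if $\nu(A_n)\to\nu(\bigcup_n A_n)$ for increasing sequences and $\nu(A_n)\to\nu(\bigcap_n A_n)$ for decreasing sequences. It is risk conforming if $\nu|_{\mathcal G}=\mathbb P$. Its core $\mathfrak C(\nu)$ is the set of countably additive probability measures $\mu$ on $\mathcal F$ with $\mu(A)\ge\nu(A)$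 for all $A\in\mathcal F$. A distortion function is an increasing $g:[0,1]\to[0,1]$ with $g(0)=0$, $g(1)=1$. The Choquet integral is $\int X\,\mathrm d\nu=\int_0^\infty\nu(X>x)\,\mathrm dx+\int_{-\infty}^0(\nu(X>x)-1)\,\mathrm dx$. A preference relation $\succsim$ is a CRDU preference relation if there are a continuous strictly increasing $u:\mathbb R\to\mathbb R$, a continuous strictly increasing distortion function $g$, and a continuous risk-conforming capacity $\nu$ such that $X\succsim Y\iff\int u(X)\,\mathrm d(g\circ\nu)\ge\int u(Y)\,\mathrm d(g\circ\nu)$ for all $X,Y\in\mathcal X$. A $\succsim$-matching probability is a function $\nu:\mathcal F\to[0,1]$ such that for every $A\in\mathcal F$ there is $R_A\in\mathcal G$ with $\nu(A)=\mathbb P(R_A)$ and $\mathbf 1_A\simeq\mathbf 1_{R_A}$. For a CRDU preference relation it exists, is unique, and equals the capacity $\nu$ in the representation. Property (RAA), reference ambiguity aversion: for all $X\in\mathcal X(\mathcal G)$ and $Y\in\mathcal X$ with $\mathbb Q(X>x)=\mathbb Q(Y>x)$ for all $x\in\mathbb R$, $X\succsim Y$. *)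

theory Defs
  imports "HOL-Probability.Probability"
begin

text \<open>
  A sigma-algebra is carried by a value of type \<open>'a measure\<close>: throughout, \<open>M\<close> stands for the
  measurable space of all events, of which only \<open>space M\<close> and \<open>sets M\<close> are used, and \<open>P\<close> for the
  reference probability on the sub-sigma-algebra \<open>sets P\<close>.  Set functions have type
  \<open>'a set \<Rightarrow> real\<close>; only their values on \<open>sets M\<close> matter.
\<close>

definition atomless :: "'a measure \<Rightarrow> bool" where
  "atomless P \<longleftrightarrow>
     (\<forall>A\<in>sets P. {measure P B |B. B \<in> sets P \<and> B \<subseteq> A} = {0..measure P A})"

definition acts :: "'a measure \<Rightarrow> ('a \<Rightarrow> real) set" where
  "acts M = {X \<in> borel_measurable M. bounded (X ` space M)}"

definition preference_relation ::
  "'a measure \<Rightarrow> (('a \<Rightarrow> real) \<Rightarrow> ('a \<Rightarrow> real) \<Rightarrow> bool) \<Rightarrow> bool" where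
  "preference_relation M pref \<longleftrightarrow>
     reflp_on (acts M) pref \<and> transp_on (acts M) pref \<and> totalp_on (acts M) pref"

definition indifferent ::
  "(('a \<Rightarrow> real) \<Rightarrow> ('a \<Rightarrow> real) \<Rightarrow> bool) \<Rightarrow> ('a \<Rightarrow> real) \<Rightarrow> ('a \<Rightarrow> real) \<Rightarrow> bool" where
  "indifferent pref X Y \<longleftrightarrow> pref X Y \<and> pref Y X"

definition capacity :: "'a measure \<Rightarrow> ('a set \<Rightarrow> real) \<Rightarrow> bool" where
  "capacity M \<nu> \<longleftrightarrow> \<nu> {} = 0 \<and> \<nu> (space M) = 1 \<and>
     (\<forall>A\<in>sets M. \<forall>B\<in>sets M. A \<subseteq> B \<longrightarrow> \<nu> A \<le> \<nu> B)"

definition continuous_capacity :: "'a measure \<Rightarrow> ('a set \<Rightarrow> real) \<Rightarrow> bool" where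
  "continuous_capacity M \<nu> \<longleftrightarrow> capacity M \<nu> \<and>
     (\<forall>A. range A \<subseteq> sets M \<and> incseq A \<longrightarrow> (\<lambda>n. \<nu> (A n)) \<longlonglongrightarrow> \<nu> (\<Union>n::nat. A n)) \<and>
     (\<forall>A. range A \<subseteq> sets M \<and> decseq A \<longrightarrow> (\<lambda>n. \<nu> (A n)) \<longlonglongrightarrow> \<nu> (\<Inter>n::nat. A n))"

definition risk_conforming :: "'a measure \<Rightarrow> ('a set \<Rightarrow> real) \<Rightarrow> bool" where
  "risk_conforming P \<nu> \<longleftrightarrow> (\<forall>A\<in>sets P. \<nu> A = measure P A)"

definition core :: "'a measure \<Rightarrow> ('a set \<Rightarrow> real) \<Rightarrow> 'a measure set" where
  "core M \<nu> =
     {\<mu>. prob_space \<mu> \<and> sets \<mu> = sets M \<and> (\<forall>A\<in>sets M. measure \<mu> A \<ge> \<nu> A)}"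

definition distortion_function :: "(real \<Rightarrow> real) \<Rightarrow> bool" where
  "distortion_function g \<longleftrightarrow>
     g ` {0..1} \<subseteq> {0..1} \<and> mono_on {0..1} g \<and> g 0 = 0 \<and> g 1 = 1"

definition choquet_integral :: "'a measure \<Rightarrow> ('a set \<Rightarrow> real) \<Rightarrow> ('a \<Rightarrow> real) \<Rightarrow> real" where
  "choquet_integral M \<nu> X =
     (LINT x:{0..}|lborel. \<nu> {\<omega> \<in> space M. X \<omega> > x}) +
     (LINT x:{..0}|lborel. (\<nu> {\<omega> \<in> space M. X \<omega> > x} - 1))"

definition CRDU ::
  "'a measure \<Rightarrow> 'a measure \<Rightarrow> (('a \<Rightarrow> real) \<Rightarrow> ('a \<Rightarrow> real) \<Rightarrow> bool) \<Rightarrow> bool" where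
  "CRDU M P pref \<longleftrightarrow> preference_relation M pref \<and>
     (\<exists>(u :: real \<Rightarrow> real) g \<nu>.
        continuous_on UNIV u \<and> strict_mono u \<and>
        distortion_function g \<and> continuous_on {0..1} g \<and> strict_mono_on {0..1} g \<and>
        continuous_capacity M \<nu> \<and> risk_conforming P \<nu> \<and>
        (\<forall>X\<in>acts M. \<forall>Y\<in>acts M. pref X Y \<longleftrightarrow>
           choquet_integral M (g \<circ> \<nu>) (u \<circ> X) \<ge> choquet_integral M (g \<circ> \<nu>) (u \<circ> Y)))"

definition matching_probability ::
  "'a measure \<Rightarrow> 'a measure \<Rightarrow> (('a \<Rightarrow> real) \<Rightarrow> ('a \<Rightarrow> real) \<Rightarrow> bool) \<Rightarrow> ('a set \<Rightarrow> real) \<Rightarrow> bool"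
where
  "matching_probability M P pref \<nu> \<longleftrightarrow>
     (\<forall>A\<in>sets M. \<nu> A \<in> {0..1} \<and>
        (\<exists>R\<in>sets P. \<nu> A = measure P R \<and> indifferent pref (indicator A) (indicator R)))"

definition RAA ::
  "'a measure \<Rightarrow> 'a measure \<Rightarrow> 'a measure \<Rightarrow> (('a \<Rightarrow> real) \<Rightarrow> ('a \<Rightarrow> real) \<Rightarrow> bool) \<Rightarrow> bool" where
  "RAA M P Q pref \<longleftrightarrow>
     (\<forall>X\<in>acts P. \<forall>Y\<in>acts M.
        (\<forall>x. measure Q {\<omega> \<in> space M. X \<omega> > x} = measure Q {\<omega> \<in> space M. Y \<omega> > x}) \<longrightarrow>
        pref X Y)"

end

theory Submission
  imports Defs
begin

text \<open>
  On indicators the Choquet functional of \<open>u\<close> under \<open>g \<circ> \<nu>\<close> is a strictly increasing function of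
  the capacity of the event, so the matching probability is the capacity of the representation.
  By atomlessness every event \<open>A\<close> has the same \<open>Q\<close>-probability as some reference event \<open>B\<close>, and
  (RAA) applied to the indicators of \<open>B\<close> and \<open>A\<close> is the inequality \<open>\<nu> A \<le> Q A\<close>.  Conversely,
  set-wise dominance compares the two Choquet integrands level by level.
\<close>

section \<open>Measurability, integrability and comparison of Choquet integrands\<close>

abbreviation upper_level :: "'a measure \<Rightarrow> ('a \<Rightarrow> real) \<Rightarrow> real \<Rightarrow> 'a set" where
  "upper_level M X x \<equiv> {\<omega> \<in> space M. X \<omega> > x}"

lemma upper_level_sets: "X \<in> acts M \<Longrightarrow> upper_level M X x \<in> sets M"
  by (auto simp: acts_def)

lemma capacity_bounds:
  assumes "capacity M \<mu>" "A \<in> sets M"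
  shows "0 \<le> \<mu> A" "\<mu> A \<le> 1"
proof -
  have "{} \<subseteq> A" "A \<subseteq> space M" using assms(2) sets.sets_into_space by auto
  with assms show "0 \<le> \<mu> A" "\<mu> A \<le> 1"
    unfolding capacity_def by (metis sets.empty_sets sets.top)+
qed

text \<open>Upper levels shrink as \<open>x\<close> grows, so monotonicity of the capacity makes
  this function decreasing. The sign change in the proof turns it into an increasing one, and
  monotone real functions are Borel.\<close>

lemma survival_borel_measurable:
  assumes "capacity M \<mu>" "X \<in> acts M"
  shows "(\<lambda>x. \<mu> (upper_level M X x)) \<in> borel_measurable borel"
proof -
  have "mono (\<lambda>x. - \<mu> (upper_level M X x))"
  proof (rule monoI)
    fix x y :: real assume "x \<le> y"
    then have "upper_level M X y \<subseteq> upper_level M X x" by auto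
    then show "- \<mu> (upper_level M X x) \<le> - \<mu> (upper_level M X y)"
      using assms(1) upper_level_sets[OF assms(2)] unfolding capacity_def by simp
  qed
  from borel_measurable_uminus[OF borel_measurable_mono[OF this]] show ?thesis by simp
qed

text \<open>If \<open>K\<close> bounds the act, both integrands vanish outside
  \<open>{-K..K}\<close> and have absolute value at most 1. Integrability is what licenses splitting
  the integral of a difference, since the integral of a non-integrable function is 0 by
  default.\<close>

lemma survival_set_integrable:
  assumes c: "capacity M \<mu>" and X: "X \<in> acts M"
  shows "set_integrable lborel {0..} (\<lambda>x. \<mu> (upper_level M X x))"
    and "set_integrable lborel {..0} (\<lambda>x. \<mu> (upper_level M X x) - 1)"
proof -
  obtain K where K0: "K > 0" and K: "\<And>\<omega>. \<omega> \<in> space M \<Longrightarrow> \<bar>X \<omega>\<bar> \<le> K"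
    using X by (auto simp: acts_def bounded_pos)
  have dom: "integrable lborel (indicator {-K..K} :: real \<Rightarrow> real)"
    by (rule integrable_real_indicator) (use K0 in auto)
  note meas[measurable] = survival_borel_measurable[OF c X]
  have above: "\<mu> (upper_level M X x) = 0" if "x > K" for x
  proof -
    have "upper_level M X x = {}" using K that by fastforce
    then show ?thesis using c by (simp only: capacity_def)
  qed
  have below: "\<mu> (upper_level M X x) = 1" if "x < - K" for x
  proof -
    have "upper_level M X x = space M" using K that by fastforce
    then show ?thesis using c by (simp only: capacity_def)
  qed
  note bnd = capacity_bounds[OF c upper_level_sets[OF X]]
  show "set_integrable lborel {0..} (\<lambda>x. \<mu> (upper_level M X x))"
    unfolding set_integrable_def
  proof (rule Bochner_Integration.integrable_bound[OF dom])
    show "AE x in lborel. norm (indicator {0..} x *\<^sub>R \<mu> (upper_level M X x))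
            \<le> norm (indicator {-K..K} x :: real)"
      using bnd above K0 by (intro AE_I2) (auto simp: indicator_def not_le)
  qed measurable
  show "set_integrable lborel {..0} (\<lambda>x. \<mu> (upper_level M X x) - 1)"
    unfolding set_integrable_def
  proof (rule Bochner_Integration.integrable_bound[OF dom])
    show "AE x in lborel. norm (indicator {..0} x *\<^sub>R (\<mu> (upper_level M X x) - 1))
            \<le> norm (indicator {-K..K} x :: real)"
      using bnd below K0 by (intro AE_I2) (auto simp: indicator_def not_le)
  qed measurable
qed

text \<open>Taking differences removes the case distinction at \<open>0\<close> in the definition.\<close>

lemma choquet_integral_diff:
  assumes c: "capacity M \<mu>" and X: "X \<in> acts M" and Y: "Y \<in> acts M"
  shows "choquet_integral M \<mu> X - choquet_integral M \<mu> Y =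
           (LINT x|lborel. \<mu> (upper_level M X x) - \<mu> (upper_level M Y x))"
proof -
  note iX = survival_set_integrable[OF c X] and iY = survival_set_integrable[OF c Y]
  let ?d = "\<lambda>x. \<mu> (upper_level M X x) - \<mu> (upper_level M Y x)"
  have p: "set_integrable lborel {0..} ?d"
    using set_integral_diff(1)[OF iX(1) iY(1)] .
  have n: "set_integrable lborel {..0} ?d"
    using set_integral_diff(1)[OF iX(2) iY(2)] by simp
  have "choquet_integral M \<mu> X - choquet_integral M \<mu> Y =
          (LINT x:{0..}|lborel. ?d x) + (LINT x:{..0}|lborel. ?d x)"
    using set_integral_diff(2)[OF iX(1) iY(1)] set_integral_diff(2)[OF iX(2) iY(2)]
    unfolding choquet_integral_def by simp
  also have "\<dots> = (LINT x:{0..} \<union> {..0}|lborel. ?d x)"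
  proof (rule set_integral_Un_AE[symmetric, OF _ _ _ p n])
    \<comment> \<open>The two half-lines overlap only in the point 0, which is Lebesgue
      null.\<close>
    show "AE x in lborel. \<not> (x \<in> {0::real..} \<and> x \<in> {..0})"
      using AE_lborel_singleton[of 0] by eventually_elim auto
  qed auto
  also have "{0..} \<union> {..0} = (UNIV :: real set)" by auto
  finally show ?thesis by (simp add: set_lebesgue_integral_def)
qed

lemma choquet_integral_mono:
  assumes "capacity M \<mu>" "X \<in> acts M" "Y \<in> acts M"
    and "\<And>x. \<mu> (upper_level M X x) \<le> \<mu> (upper_level M Y x)"
  shows "choquet_integral M \<mu> X \<le> choquet_integral M \<mu> Y"
proof -
  have "0 \<le> (LINT x|lborel. \<mu> (upper_level M Y x) - \<mu> (upper_level M X x))"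
    using assms(4) by (intro integral_nonneg_AE AE_I2) simp
  with choquet_integral_diff[OF assms(1,3,2)] show ?thesis by simp
qed

section \<open>Utility transforms, indicators and the matching probability\<close>

lemma indicator_acts: "A \<in> sets M \<Longrightarrow> indicator A \<in> acts M"
  unfolding acts_def bounded_iff by (auto intro!: exI[of _ 1] simp: indicator_def)

lemma acts_strict_mono_comp:
  assumes "continuous_on UNIV u" "strict_mono u" "X \<in> acts M"
  shows "u \<circ> X \<in> acts M"
proof -
  obtain K where K: "\<And>\<omega>. \<omega> \<in> space M \<Longrightarrow> \<bar>X \<omega>\<bar> \<le> K"
    using assms(3) by (auto simp: acts_def bounded_iff)
  have "(u \<circ> X) ` space M \<subseteq> {u (-K)..u K}"
    using K strict_mono_less_eq[OF assms(2)] by (fastforce simp: abs_le_iff)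
  then have "bounded ((u \<circ> X) ` space M)"
    using bounded_subset bounded_closed_interval by blast
  moreover have "u \<circ> X \<in> borel_measurable M"
    using assms(3) borel_measurable_continuous_onI[OF assms(1)]
    unfolding acts_def by (auto intro: measurable_comp)
  ultimately show ?thesis by (simp add: acts_def)
qed

text \<open>Only thresholds in \<open>{u 0..<u 1}\<close> separate the two transformed indicators.
  Below this interval both upper levels are the whole space and above it both are empty, so the
  integrand of the difference cancels there. Working with the difference makes the signs of
  \<open>u 0\<close> and \<open>u 1\<close> irrelevant.\<close>

lemma choquet_integral_indicator_diff:
  fixes u :: "real \<Rightarrow> real"
  assumes c: "capacity M \<mu>" and u: "continuous_on UNIV u" "strict_mono u"
    and A: "A \<in> sets M" and B: "B \<in> sets M"
  shows "choquet_integral M \<mu> (u \<circ> indicator A) - choquet_integral M \<mu> (u \<circ> indicator B) =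
           (u 1 - u 0) * (\<mu> A - \<mu> B)"
proof -
  have u01: "u 0 < u 1" using strict_monoD[OF u(2), of 0 1] by simp
  have level: "upper_level M (u \<circ> indicator C) x =
          (if x < u 0 then space M else if x < u 1 then C else {})" if "C \<in> sets M" for C x
    using sets.sets_into_space[OF that] u01 by (auto simp: indicator_def split: if_splits)
  have "choquet_integral M \<mu> (u \<circ> indicator A) - choquet_integral M \<mu> (u \<circ> indicator B) =
        (LINT x|lborel. \<mu> (upper_level M (u \<circ> indicator A) x)
                          - \<mu> (upper_level M (u \<circ> indicator B) x))"
    using A B by (intro choquet_integral_diff c acts_strict_mono_comp u indicator_acts)
  also have "\<dots> = (LINT x|lborel. indicator {u 0..<u 1} x *\<^sub>R (\<mu> A - \<mu> B))"
    unfolding level[OF A] level[OF B]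
    by (rule Bochner_Integration.integral_cong) (auto simp: indicator_def)
  also have "\<dots> = (u 1 - u 0) * (\<mu> A - \<mu> B)"
    using u01 by simp
  finally show ?thesis .
qed

lemma capacity_distortion:
  assumes g: "distortion_function g" and c: "capacity M \<nu>"
  shows "capacity M (g \<circ> \<nu>)"
  using g c capacity_bounds[OF c] mono_onD[of "{0..1}" g]
  unfolding distortion_function_def capacity_def by auto

text \<open>Each alternative holds uniformly in \<open>X\<close>: the threshold \<open>y\<close>
  depends on \<open>u\<close> and \<open>x\<close> only, so one \<open>y\<close> serves both acts in
  a comparison. The last two alternatives occur because \<open>u\<close> may be bounded above or
  below.\<close>

lemma upper_level_strict_mono_comp:
  fixes u :: "real \<Rightarrow> real"
  assumes u: "continuous_on UNIV u" "strict_mono u"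
  shows "(\<exists>y. \<forall>X. upper_level M (u \<circ> X) x = upper_level M X y) \<or>
         (\<forall>X. upper_level M (u \<circ> X) x = space M) \<or> (\<forall>X. upper_level M (u \<circ> X) x = {})"
proof (cases "x \<in> range u")
  case True
  then show ?thesis using strict_mono_less[OF u(2)] by auto
next
  case False
  \<comment> \<open>The range of \<open>u\<close> is an interval, so a value outside it lies
    entirely below or entirely above it.\<close>
  have "connected (range u)" using connected_continuous_image[OF u(1)] by simp
  then have "\<not> (u a < x \<and> x < u b)" for a b
    using False connectedD_interval[of "range u" "u a" "u b" x] by auto
  moreover have "u a \<noteq> x" for a using False by auto
  ultimately have "(\<forall>a. x < u a) \<or> (\<forall>a. u a < x)" by (meson linorder_neqE_linordered_idom)
  then show ?thesis by (auto simp: order.strict_iff_not)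
qed

text \<open>Indifference between an event and its matching reference event equates their distorted
  capacities. Injectivity of \<open>g\<close> on \<open>{0..1}\<close> removes the distortion, and
  risk conformity evaluates the reference event.\<close>

lemma CRDU_matching_representation:
  assumes sub: "subalgebra M P" and crdu: "CRDU M P pref"
    and match: "matching_probability M P pref \<nu>"
  obtains u g where "continuous_on UNIV u" "strict_mono u"
    and "distortion_function g" "strict_mono_on {0..1} g"
    and "capacity M \<nu>" "\<forall>A\<in>sets P. \<nu> A = measure P A"
    and "\<And>X Y. X \<in> acts M \<Longrightarrow> Y \<in> acts M \<Longrightarrow> pref X Y \<longleftrightarrow>
           choquet_integral M (g \<circ> \<nu>) (u \<circ> X) \<ge> choquet_integral M (g \<circ> \<nu>) (u \<circ> Y)"
proof -
  obtain u g \<nu>' where u: "continuous_on UNIV u" "strict_mono u"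
    and g: "distortion_function g" "strict_mono_on {0..1} g"
    and c: "capacity M \<nu>'" and risk: "\<forall>A\<in>sets P. \<nu>' A = measure P A"
    and rep: "\<forall>X\<in>acts M. \<forall>Y\<in>acts M. pref X Y \<longleftrightarrow>
       choquet_integral M (g \<circ> \<nu>') (u \<circ> X) \<ge> choquet_integral M (g \<circ> \<nu>') (u \<circ> Y)"
    using crdu unfolding CRDU_def continuous_capacity_def risk_conforming_def by blast
  have PM: "A \<in> sets M" if "A \<in> sets P" for A using sub that by (auto simp: subalgebra_def)
  have eq: "\<nu> A = \<nu>' A" if A: "A \<in> sets M" for A
  proof -
    obtain R where R: "R \<in> sets P" "\<nu> A = measure P R"
      and ind: "indifferent pref (indicator A) (indicator R)"
      using match A unfolding matching_probability_def by blast
    have "choquet_integral M (g \<circ> \<nu>') (u \<circ> indicator A) =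
          choquet_integral M (g \<circ> \<nu>') (u \<circ> indicator R)"
      using ind rep indicator_acts A PM[OF R(1)]
      unfolding indifferent_def by (meson order_antisym)
    then have "(u 1 - u 0) * (g (\<nu>' A) - g (\<nu>' R)) = 0"
      using choquet_integral_indicator_diff[OF capacity_distortion[OF g(1) c] u A PM[OF R(1)]]
      by simp
    moreover have "u 1 \<noteq> u 0" using u(2) by (simp add: strict_mono_eq)
    ultimately have "g (\<nu>' A) = g (\<nu>' R)" by simp
    then have "\<nu>' A = \<nu>' R"
      using strict_mono_on_eqD[OF g(2)] capacity_bounds[OF c A] capacity_bounds[OF c PM[OF R(1)]]
      by simp
    with R risk show ?thesis by simp
  qed
  \<comment> \<open>The two set functions are known to agree only on \<open>sets M\<close>. This
    suffices, because the Choquet integral of an act evaluates them only at its upper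
    levels.\<close>
  have ci: "choquet_integral M (g \<circ> \<nu>) X = choquet_integral M (g \<circ> \<nu>') X" if "X \<in> acts M" for X
    using eq[OF upper_level_sets[OF that]] unfolding choquet_integral_def by simp
  show thesis
  proof (rule that[OF u g])
    show "capacity M \<nu>" using c eq unfolding capacity_def by simp
    show "\<forall>A\<in>sets P. \<nu> A = measure P A" using risk eq PM by simp
    show "pref X Y \<longleftrightarrow>
        choquet_integral M (g \<circ> \<nu>) (u \<circ> X) \<ge> choquet_integral M (g \<circ> \<nu>) (u \<circ> Y)"
      if "X \<in> acts M" "Y \<in> acts M" for X Y
      unfolding ci[OF acts_strict_mono_comp[OF u that(1)]] ci[OF acts_strict_mono_comp[OF u that(2)]]
      using rep that by blast
  qed
qed

section \<open>Reference ambiguity aversion against set-wise dominance\<close>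

theorem proposition9:
  fixes M P Q :: "'a measure"
    and pref :: "('a \<Rightarrow> real) \<Rightarrow> ('a \<Rightarrow> real) \<Rightarrow> bool"
    and \<nu> :: "'a set \<Rightarrow> real"
  assumes "subalgebra M P"
    and "prob_space P" and "atomless P"
    and "prob_space Q" and "sets Q = sets M"
    and "\<forall>A\<in>sets P. measure Q A = measure P A"
    and "CRDU M P pref"
    and "matching_probability M P pref \<nu>"
  shows "(RAA M P Q pref \<longleftrightarrow> (\<forall>A\<in>sets M. \<nu> A \<le> measure Q A)) \<and>
         ((\<forall>A\<in>sets M. \<nu> A \<le> measure Q A) \<longleftrightarrow> Q \<in> core M \<nu>)"
proof -
  interpret P: prob_space P by fact
  interpret Q: prob_space Q by fact
  have spP: "space P = space M" and PM: "\<And>A. A \<in> sets P \<Longrightarrow> A \<in> sets M"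
    using assms(1) by (auto simp: subalgebra_def)
  have spQ: "space Q = space M" using sets_eq_imp_space_eq[OF assms(5)] .
  obtain u g where u: "continuous_on UNIV u" "strict_mono u"
    and g: "distortion_function g" "strict_mono_on {0..1} g"
    and c: "capacity M \<nu>" and risk: "\<forall>A\<in>sets P. \<nu> A = measure P A"
    and rep: "\<And>X Y. X \<in> acts M \<Longrightarrow> Y \<in> acts M \<Longrightarrow> pref X Y \<longleftrightarrow>
           choquet_integral M (g \<circ> \<nu>) (u \<circ> X) \<ge> choquet_integral M (g \<circ> \<nu>) (u \<circ> Y)"
    using CRDU_matching_representation[OF assms(1,7,8)] by blast
  note cg = capacity_distortion[OF g(1) c]
  note bnd = capacity_bounds[OF c]
  have "\<nu> A \<le> measure Q A" if raa: "RAA M P Q pref" and A: "A \<in> sets M" for A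
  proof -
    \<comment> \<open>Atomlessness is applied to the whole space, whose probability is 1, so every
      value in \<open>{0..1}\<close> is attained; \<open>B\<close> need not be related to
      \<open>A\<close> as a set.\<close>
    have "measure Q A \<in> {measure P B |B. B \<in> sets P \<and> B \<subseteq> space P}"
      using assms(3) sets.top[of P] by (simp add: atomless_def P.prob_space)
    then obtain B where B: "B \<in> sets P" "measure P B = measure Q A" by auto
    \<comment> \<open>These are the levels of the indicators themselves, without \<open>u\<close>:
      they show that equal \<open>Q\<close>-probabilities of the two events give equal distributions
      under \<open>Q\<close>, as (RAA) requires.\<close>
    have level: "upper_level M (indicator C) x =
          (if x < 0 then space M else if x < 1 then C else {})" if "C \<in> sets M" for C x
      using sets.sets_into_space[OF that] by (auto simp: indicator_def split: if_splits)
    have "pref (indicator B) (indicator A)"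
      using raa indicator_acts[OF B(1)] indicator_acts[OF A] assms(6) B
      unfolding RAA_def by (simp add: level[OF A] level[OF PM[OF B(1)]])
    then have "0 \<le> (u 1 - u 0) * (g (\<nu> B) - g (\<nu> A))"
      using rep[OF indicator_acts[OF PM[OF B(1)]] indicator_acts[OF A]]
        choquet_integral_indicator_diff[OF cg u PM[OF B(1)] A] by simp
    moreover have "u 0 < u 1" using strict_monoD[OF u(2), of 0 1] by simp
    ultimately have "g (\<nu> A) \<le> g (\<nu> B)" by (simp add: zero_le_mult_iff)
    \<comment> \<open>Strict monotonicity of \<open>g\<close> is used contrapositively:
      \<open>\<nu> B < \<nu> A\<close> would give \<open>g (\<nu> B) < g (\<nu> A)\<close>.\<close>
    then have "\<nu> A \<le> \<nu> B"
      using strict_mono_onD[OF g(2), of "\<nu> B" "\<nu> A"] bnd[OF A] bnd[OF PM[OF B(1)]]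
      by (auto simp: not_le[symmetric])
    with risk B show ?thesis by simp
  qed
  moreover have "RAA M P Q pref" if dom: "\<forall>A\<in>sets M. \<nu> A \<le> measure Q A"
    unfolding RAA_def
  proof (intro ballI impI)
    fix X Y
    assume XP: "X \<in> acts P" and Y: "Y \<in> acts M"
      and eq: "\<forall>x. measure Q (upper_level M X x) = measure Q (upper_level M Y x)"
    have X: "X \<in> acts M"
      using XP spP measurable_from_subalg[OF assms(1)] by (auto simp: acts_def)
    \<comment> \<open>The upper levels of \<open>X\<close> are reference events, where
      \<open>\<nu>\<close> agrees with \<open>Q\<close>. Equality in distribution moves their
      \<open>Q\<close>-probability to \<open>Y\<close>, and dominance bounds \<open>\<nu>\<close> on
      the levels of \<open>Y\<close> by it.\<close>
    have le: "\<nu> (upper_level M Y y) \<le> \<nu> (upper_level M X y)" for y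
    proof -
      have "upper_level M X y \<in> sets P" using upper_level_sets[OF XP, of y] unfolding spP .
      then have "\<nu> (upper_level M X y) = measure Q (upper_level M X y)"
        using risk assms(6) by metis
      moreover have "measure Q (upper_level M X y) = measure Q (upper_level M Y y)"
        using eq by (rule spec)
      moreover have "\<nu> (upper_level M Y y) \<le> measure Q (upper_level M Y y)"
        using dom upper_level_sets[OF Y] by (rule bspec)
      ultimately show ?thesis by linarith
    qed
    have "(g \<circ> \<nu>) (upper_level M (u \<circ> Y) x) \<le> (g \<circ> \<nu>) (upper_level M (u \<circ> X) x)" for x
    proof -
      note meas = upper_level_sets[OF acts_strict_mono_comp[OF u X], of x]
        upper_level_sets[OF acts_strict_mono_comp[OF u Y], of x]
      \<comment> \<open>A threshold \<open>x\<close> for utilities becomes a common threshold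
        \<open>y\<close> for outcomes, or else both upper levels are the whole space or both are
        empty.\<close>
      have "\<nu> (upper_level M (u \<circ> Y) x) \<le> \<nu> (upper_level M (u \<circ> X) x)"
        using upper_level_strict_mono_comp[OF u, of M x]
      proof (elim disjE exE)
        fix y assume "\<forall>X. upper_level M (u \<circ> X) x = upper_level M X y"
        then have "upper_level M (u \<circ> X) x = upper_level M X y"
          "upper_level M (u \<circ> Y) x = upper_level M Y y" by blast+
        then show ?thesis by (simp only: le)
      qed (simp_all only: order_refl)
      then show ?thesis
        using g(1) mono_onD[of "{0..1}" g] bnd[OF meas(1)] bnd[OF meas(2)]
        unfolding distortion_function_def by simp
    qed
    then show "pref X Y"
      unfolding rep[OF X Y]
      by (intro choquet_integral_mono cg acts_strict_mono_comp u X Y)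
  qed
  moreover have "(\<forall>A\<in>sets M. \<nu> A \<le> measure Q A) \<longleftrightarrow> Q \<in> core M \<nu>"
    using assms(4,5) by (simp add: core_def)
  ultimately show ?thesis by blast
qed

end
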